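(* Let $k\ge2$ and let $G$ be a $k$-graph with vertex set $\{1,\dots,n\}$ in which every vertex lies in at least one edge, and let $\mathcal L$ be its Laplacian tensor. The following two statements are equivalent: (a) The $k$-graph $G$ is connected. (b) The all-ones vector $\mathbf 1\in\mathbb R^n$ is the unique minimal binary H-eigenvector of $\mathcal L$ associated with the H-eigenvalue $\mu_1=0$.
   Context: A $k$-graph $G=(V,E)$ consists of a vertex set $V=\{1,\dots,n\}$ and a set $E$ of distinct $k$-element subsets of $V$ (edges). Standing assumption: every vertex lies in at least one edge. The degree $d_i$ of vertex $i$ is the number of edges containing $i$. Two vertices are adjacent if they lie in a common edge; two vertices are connected if they are joined by a finite chain of successively adjacent vertices; $G$ is connected if any two of its vertices are connected. The adjacency tensor $\mathcal A=(a_{i_1\cdots i_k})$ is the $k$th order $n$-dimensional symmetric tensor with $a_{i_1\cdots i_k}=\frac1{(k-1)!}$ if $\{i_1,\dots,i_k\}\in E$ (in particular the indices are then distinct), and $0$ otherwise. The degree tensor $\mathcal D$ is the $k$th order $n$-dimensional diagonal tensor with $i$th diagonal entry $d_i$. The Laplacian tensor is $\mathcal L=\mathcal D-\mathcal A$. For a real $k$th order $n$-dimensional tensor $\mathcal T=(t_{i_1\cdots i_k})$ and a vector $x$, $\mathcal Tx^{k-1}$ is the vector with $i$th component $\sum_{i_2,\dots,i_k=1}^n t_{ii_2\cdots i_k}x_{i_2}\cdots x_{i_k}$, and $x^{[k-1]}$ is the vector with components $x_i^{k-1}$. A real number $\mu$ is an H-eigenvalue of $\mathcal T$ with (associated) H-eigenvector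 $x$ if $x\in\mathbb R^n$, $x\ne0$ and $\mathcal Tx^{k-1}=\mu x^{[k-1]}$. For $x\in\mathbb R^n$, $\mathrm{supp}(x)=\{i: x_i\neq0\}$. A vector $x\in\mathbb R^n$ is binary if each $x_i$ is $0$ or $1$. A binary H-eigenvector $x$ of $\mathcal L$ associated with an H-eigenvalue $\mu$ is a minimal binary H-eigenvector associated with $\mu$ if there is no other binary H-eigenvector $y$ of $\mathcal L$ associated with $\mu$ such that $\mathrm{supp}(y)$ is a proper subset of $\mathrm{supp}(x)$. *)

theory Defs
  imports "HOL-Analysis.Analysis"
begin

text \<open>
  The vertex set \<open>{1,\<dots>,n}\<close> is the universe of a finite type \<open>'n\<close>, so
  \<open>n = CARD('n) \<ge> 1\<close>, and a hypergraph is given by its set of edges.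
\<close>

definition k_graph :: "nat \<Rightarrow> 'n::finite set set \<Rightarrow> bool" where
  "k_graph k E \<longleftrightarrow> (\<forall>e\<in>E. card e = k)"

definition vertex_degree :: "'n::finite set set \<Rightarrow> 'n \<Rightarrow> nat" where
  "vertex_degree E i = card {e \<in> E. i \<in> e}"

definition adjacent :: "'n::finite set set \<Rightarrow> 'n \<Rightarrow> 'n \<Rightarrow> bool" where
  "adjacent E u v \<longleftrightarrow> (\<exists>e\<in>E. u \<in> e \<and> v \<in> e)"

definition connected_hypergraph :: "'n::finite set set \<Rightarrow> bool" where
  "connected_hypergraph E \<longleftrightarrow> (\<forall>u v. (adjacent E)\<^sup>*\<^sup>* u v)"

text \<open>
  A tensor of order \<open>k\<close> and dimension \<open>CARD('n)\<close> is a function on index lists;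
  only its values on lists of length \<open>k\<close> are meaningful.
\<close>

type_synonym 'n tensor = "'n list \<Rightarrow> real"

text \<open>
  For a \<open>k\<close>-graph and an index list of length \<open>k\<close>, membership of \<open>set is\<close> in \<open>E\<close>
  forces the indices to be distinct.
\<close>

definition adjacency_tensor :: "nat \<Rightarrow> 'n::finite set set \<Rightarrow> 'n tensor" where
  "adjacency_tensor k E is = (if set is \<in> E then 1 / fact (k - 1) else 0)"

definition degree_tensor :: "'n::finite set set \<Rightarrow> 'n tensor" where
  "degree_tensor E is = (if set is = {hd is} then real (vertex_degree E (hd is)) else 0)"

definition laplacian_tensor :: "nat \<Rightarrow> 'n::finite set set \<Rightarrow> 'n tensor" where
  "laplacian_tensor k E is = degree_tensor E is - adjacency_tensor k E is"

text \<open>The vector \<open>T x\<^sup>k\<^sup>-\<^sup>1\<close>, for a tensor \<open>T\<close> of order \<open>k\<close>.\<close>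

definition tensor_apply :: "nat \<Rightarrow> 'n::finite tensor \<Rightarrow> real ^ 'n \<Rightarrow> real ^ 'n" where
  "tensor_apply k T x =
     (\<chi> i. \<Sum>js | length js = k - 1. T (i # js) * (\<Prod>j\<leftarrow>js. x $ j))"

definition vec_power :: "real ^ 'n \<Rightarrow> nat \<Rightarrow> real ^ 'n::finite" where
  "vec_power x m = (\<chi> i. (x $ i) ^ m)"

definition H_eigenvector :: "nat \<Rightarrow> 'n::finite tensor \<Rightarrow> real \<Rightarrow> real ^ 'n \<Rightarrow> bool" where
  "H_eigenvector k T \<mu> x \<longleftrightarrow> x \<noteq> 0 \<and> tensor_apply k T x = \<mu> *\<^sub>R vec_power x (k - 1)"

definition supp :: "real ^ 'n::finite \<Rightarrow> 'n set" where
  "supp x = {i. x $ i \<noteq> 0}"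

definition binary_vec :: "real ^ 'n::finite \<Rightarrow> bool" where
  "binary_vec x \<longleftrightarrow> (\<forall>i. x $ i = 0 \<or> x $ i = 1)"

definition minimal_binary_H_eigenvector ::
  "nat \<Rightarrow> 'n::finite tensor \<Rightarrow> real \<Rightarrow> real ^ 'n \<Rightarrow> bool" where
  "minimal_binary_H_eigenvector k T \<mu> x \<longleftrightarrow>
     binary_vec x \<and> H_eigenvector k T \<mu> x \<and>
     \<not> (\<exists>y. binary_vec y \<and> H_eigenvector k T \<mu> y \<and> supp y \<subset> supp x)"

end

theory Submission
  imports Defs "HOL-Combinatorics.Multiset_Permutations"
begin

text \<open>
  For a binary vector with support \<open>S\<close>, the \<open>i\<close>th component of \<open>\<L>x\<^sup>k\<^sup>-\<^sup>1\<close> is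
  \<open>d\<^sub>i - #{e \<ni> i. e \<subseteq> S}\<close> if \<open>i \<in> S\<close>, and \<open>- #{e \<ni> i. e - {i} \<subseteq> S}\<close> otherwise.
  As edges have at least two vertices, it vanishes for all \<open>i\<close> iff every edge
  that meets \<open>S\<close> lies in \<open>S\<close>. So the binary H-eigenvectors for the eigenvalue \<open>0\<close> are
  the indicators of the nonempty unions of connected components.
\<close>

text \<open>Among the index lists starting with \<open>i\<close>, only the constant one is diagonal,
  so a single summand survives.\<close>

lemma tensor_apply_degree_nth:
  "tensor_apply k (degree_tensor E) x $ i = real (vertex_degree E i) * (x $ i) ^ (k - 1)"
proof -
  have eq: "degree_tensor E (i # js) = (if js = replicate (k - 1) i then real (vertex_degree E i) else 0)"
    if "length js = k - 1" for js
  proof -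
    have "set (i # js) = {i} \<longleftrightarrow> js = replicate (k - 1) i"
      using that by (auto intro!: replicate_eqI split: if_splits)
    then show ?thesis
      by (simp add: degree_tensor_def)
  qed
  have "tensor_apply k (degree_tensor E) x $ i =
      (\<Sum>js | length js = k - 1.
        if js = replicate (k - 1) i then real (vertex_degree E i) * (\<Prod>j\<leftarrow>js. x $ j) else 0)"
    unfolding tensor_apply_def by (auto simp: eq intro!: sum.cong)
  also have "\<dots> = real (vertex_degree E i) * (x $ i) ^ (k - 1)"
    using finite_lists_length_eq[of "UNIV :: 'a set" "k - 1"]
    by (simp add: sum.delta' prod_list_replicate)
  finally show ?thesis .
qed

text \<open>An edge \<open>e\<close> through \<open>i\<close> is hit by exactly the (k-1)! orderings
  of \<open>e - {i}\<close>. All of them give the same product, and their number cancels the factor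
  1/(k-1)!.\<close>

lemma tensor_apply_adjacency_nth:
  assumes G: "k_graph k E"
  shows "tensor_apply k (adjacency_tensor k E) x $ i = (\<Sum>e | e \<in> E \<and> i \<in> e. \<Prod>j\<in>e - {i}. x $ j)"
proof -
  let ?Ei = "{e \<in> E. i \<in> e}"
  have card: "card (e - {i}) = k - 1" if "e \<in> ?Ei" for e
    using that G by (simp add: k_graph_def)
  have lists: "{js. length js = k - 1 \<and> set (i # js) \<in> E} = (\<Union>e\<in>?Ei. permutations_of_set (e - {i}))"
  proof (intro equalityI subsetI)
    fix js assume "js \<in> {js. length js = k - 1 \<and> set (i # js) \<in> E}"
    then have len: "length js = k - 1" and e: "insert i (set js) \<in> E"
      by auto
    have "card (insert i (set js)) = k"
      using G e by (simp add: k_graph_def)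
    then have "k > 0"
      by (metis List.finite_set card_gt_0_iff finite_insert insert_not_empty)
    \<comment> \<open>Pigeonhole: \<open>js\<close> has only \<open>k - 1\<close> entries, yet
      together with \<open>i\<close> it covers all \<open>k\<close> vertices of an edge. Hence
      \<open>js\<close> avoids \<open>i\<close> and has no repetition.\<close>
    have "card (set js) \<le> k - 1"
      using card_length[of js] len by simp
    with \<open>card (insert i (set js)) = k\<close> \<open>k > 0\<close> have "i \<notin> set js" "card (set js) = length js"
      using len by (auto simp: card_insert_if split: if_splits)
    then have "js \<in> permutations_of_set (insert i (set js) - {i})"
      by (auto simp: permutations_of_set_def card_distinct)
    with e show "js \<in> (\<Union>e\<in>?Ei. permutations_of_set (e - {i}))"
      by blast
  next
    fix js assume "js \<in> (\<Union>e\<in>?Ei. permutations_of_set (e - {i}))"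
    then obtain e where e: "e \<in> ?Ei" and js: "set js = e - {i}" "distinct js"
      by (auto simp: permutations_of_set_def)
    have "length js = k - 1"
      using card[OF e] js distinct_card[of js] by simp
    moreover have "set (i # js) = e"
      using e js by auto
    ultimately show "js \<in> {js. length js = k - 1 \<and> set (i # js) \<in> E}"
      using e by simp
  qed
  have "tensor_apply k (adjacency_tensor k E) x $ i =
      (\<Sum>js | length js = k - 1 \<and> set (i # js) \<in> E. (\<Prod>j\<leftarrow>js. x $ j) / fact (k - 1))"
    unfolding tensor_apply_def adjacency_tensor_def
    using finite_lists_length_eq[of "UNIV :: 'a set" "k - 1"]
    by (auto intro!: sum.mono_neutral_cong_right split: if_splits)
  also have "\<dots> = (\<Sum>e\<in>?Ei. \<Sum>js\<in>permutations_of_set (e - {i}). (\<Prod>j\<leftarrow>js. x $ j) / fact (k - 1))"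
    unfolding lists
    \<comment> \<open>The union is disjoint: since \<open>i\<close> lies in \<open>e\<close>, a list
      with entry set \<open>e - {i}\<close> determines \<open>e\<close>.\<close>
    by (rule sum.UNION_disjoint) (simp, simp, auto simp: permutations_of_set_def)
  also have "\<dots> = (\<Sum>e\<in>?Ei. \<Prod>j\<in>e - {i}. x $ j)"
  proof (rule sum.cong[OF refl])
    fix e assume e: "e \<in> ?Ei"
    have "(\<Sum>js\<in>permutations_of_set (e - {i}). (\<Prod>j\<leftarrow>js. x $ j) / fact (k - 1)) =
        (\<Sum>js\<in>permutations_of_set (e - {i}). (\<Prod>j\<in>e - {i}. x $ j) / fact (k - 1))"
      by (intro sum.cong refl)
        (auto simp: permutations_of_set_def simp flip: prod.distinct_set_conv_list)
    also have "\<dots> = (\<Prod>j\<in>e - {i}. x $ j)"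
      using card[OF e] by simp
    finally show "(\<Sum>js\<in>permutations_of_set (e - {i}). (\<Prod>j\<leftarrow>js. x $ j) / fact (k - 1)) =
        (\<Prod>j\<in>e - {i}. x $ j)" .
  qed
  finally show ?thesis .
qed

lemma tensor_apply_laplacian_nth:
  assumes "k_graph k E"
  shows "tensor_apply k (laplacian_tensor k E) x $ i =
    real (vertex_degree E i) * (x $ i) ^ (k - 1) - (\<Sum>e | e \<in> E \<and> i \<in> e. \<Prod>j\<in>e - {i}. x $ j)"
proof -
  have "tensor_apply k (laplacian_tensor k E) x $ i =
      tensor_apply k (degree_tensor E) x $ i - tensor_apply k (adjacency_tensor k E) x $ i"
    by (simp add: tensor_apply_def laplacian_tensor_def left_diff_distrib sum_subtractf)
  then show ?thesis
    using assms by (simp add: tensor_apply_degree_nth tensor_apply_adjacency_nth)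
qed

lemma binary_vec_prod:
  assumes "binary_vec x"
  shows "(\<Prod>j\<in>A. x $ j) = of_bool (A \<subseteq> supp x)"
proof (cases "A \<subseteq> supp x")
  case True
  then have "x $ j = 1" if "j \<in> A" for j
    using that assms by (auto simp: supp_def binary_vec_def)
  with True show ?thesis
    by simp
next
  case False
  then show ?thesis
    by (auto simp: supp_def)
qed

text \<open>Powers and products of 0/1 entries are again 0 or 1, which turns the sum over edges into
  a count.\<close>

lemma tensor_apply_laplacian_binary_nth:
  assumes "k_graph k E" and "k \<ge> 2" and x: "binary_vec x"
  shows "tensor_apply k (laplacian_tensor k E) x $ i =
    real (vertex_degree E i) * of_bool (i \<in> supp x) - real (card {e \<in> E. i \<in> e \<and> e - {i} \<subseteq> supp x})"
proof -
  have "(x $ i) ^ (k - 1) = of_bool (i \<in> supp x)"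
    \<comment> \<open>The exponent \<open>k - 1\<close> is positive, which excludes
      \<open>0 ^ 0 = 1\<close>.\<close>
    using x \<open>k \<ge> 2\<close> by (cases "x $ i = 0") (auto simp: binary_vec_def supp_def)
  moreover have "(\<Sum>e | e \<in> E \<and> i \<in> e. \<Prod>j\<in>e - {i}. x $ j) =
      real (card {e \<in> E. i \<in> e \<and> e - {i} \<subseteq> supp x})"
    by (simp add: binary_vec_prod[OF x] Int_def conj_assoc)
  ultimately show ?thesis
    using assms(1) by (simp add: tensor_apply_laplacian_nth)
qed

lemma laplacian_binary_null_iff:
  assumes G: "k_graph k E" and k: "k \<ge> 2" and x: "binary_vec x"
  shows "tensor_apply k (laplacian_tensor k E) x = 0 \<longleftrightarrow> (\<forall>e\<in>E. e \<inter> supp x \<noteq> {} \<longrightarrow> e \<subseteq> supp x)"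
proof
  assume null: "tensor_apply k (laplacian_tensor k E) x = 0"
  show "\<forall>e\<in>E. e \<inter> supp x \<noteq> {} \<longrightarrow> e \<subseteq> supp x"
  proof (intro ballI impI)
    fix e assume e: "e \<in> E" "e \<inter> supp x \<noteq> {}"
    then obtain i where i: "i \<in> e" "i \<in> supp x"
      by auto
    \<comment> \<open>The component at \<open>i\<close> is the degree minus the number of edges at
      \<open>i\<close> inside the support. If it vanishes, these two nested finite sets of edges
      have equal size, so they coincide.\<close>
    have "card {e \<in> E. i \<in> e} = card {e \<in> E. i \<in> e \<and> e - {i} \<subseteq> supp x}"
      using tensor_apply_laplacian_binary_nth[OF G k x, of i] i null
      by (simp add: vertex_degree_def)
    then have "{e \<in> E. i \<in> e \<and> e - {i} \<subseteq> supp x} = {e \<in> E. i \<in> e}"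
      by (intro card_subset_eq) auto
    with e i show "e \<subseteq> supp x"
      by blast
  qed
next
  assume closed: "\<forall>e\<in>E. e \<inter> supp x \<noteq> {} \<longrightarrow> e \<subseteq> supp x"
  have "tensor_apply k (laplacian_tensor k E) x $ i = 0" for i
  proof (cases "i \<in> supp x")
    case True
    then have "{e \<in> E. i \<in> e \<and> e - {i} \<subseteq> supp x} = {e \<in> E. i \<in> e}"
      using closed by blast
    with True show ?thesis
      using tensor_apply_laplacian_binary_nth[OF G k x, of i] by (simp add: vertex_degree_def)
  next
    case False
    \<comment> \<open>The degree term is zero outside the support, so no edge at \<open>i\<close>
      may be counted. As \<open>k \<ge> 2\<close>, a counted edge would have a second vertex in the
      support, and closedness would force \<open>i\<close> into it too.\<close>
    have "\<not> e - {i} \<subseteq> supp x" if e: "e \<in> E" "i \<in> e" for e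
    proof
      assume sub: "e - {i} \<subseteq> supp x"
      have "card (e - {i}) \<noteq> 0"
        using G k e by (simp add: k_graph_def)
      then have "e - {i} \<noteq> {}"
        by (metis card.empty)
      with sub closed e have "e \<subseteq> supp x"
        by blast
      with e False show False
        by blast
    qed
    then have "{e \<in> E. i \<in> e \<and> e - {i} \<subseteq> supp x} = {}"
      by blast
    with False show ?thesis
      using tensor_apply_laplacian_binary_nth[OF G k x, of i] by simp
  qed
  then show "tensor_apply k (laplacian_tensor k E) x = 0"
    by (simp add: vec_eq_iff)
qed

text \<open>For the eigenvalue 0 the right-hand side of the eigenvalue equation vanishes, so being
  an eigenvector becomes a condition on the support alone.\<close>

lemma H_eigenvector_laplacian_binary_iff:
  assumes "k_graph k E" and "k \<ge> 2" and "binary_vec x"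
  shows "H_eigenvector k (laplacian_tensor k E) 0 x \<longleftrightarrow>
    supp x \<noteq> {} \<and> (\<forall>e\<in>E. e \<inter> supp x \<noteq> {} \<longrightarrow> e \<subseteq> supp x)"
proof -
  have "x \<noteq> 0 \<longleftrightarrow> supp x \<noteq> {}"
    by (auto simp: supp_def vec_eq_iff)
  then show ?thesis
    using laplacian_binary_null_iff[OF assms] by (simp add: H_eigenvector_def)
qed

text \<open>A set closed under edges contains everything reachable from any of its vertices.
  Conversely, the set of vertices reachable from a given one is closed.\<close>

lemma connected_hypergraph_iff_closed:
  "connected_hypergraph E \<longleftrightarrow>
    (\<forall>S. S \<noteq> {} \<longrightarrow> (\<forall>e\<in>E. e \<inter> S \<noteq> {} \<longrightarrow> e \<subseteq> S) \<longrightarrow> S = UNIV)"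
proof (intro iffI allI impI)
  fix S
  assume conn: "connected_hypergraph E" and "S \<noteq> {}"
    and closed: "\<forall>e\<in>E. e \<inter> S \<noteq> {} \<longrightarrow> e \<subseteq> S"
  obtain u where u: "u \<in> S"
    using \<open>S \<noteq> {}\<close> by blast
  have "v \<in> S" if "(adjacent E)\<^sup>*\<^sup>* u v" for v
    using that
  proof induction
    case base
    show ?case by (rule u)
  next
    case (step y z)
    then show ?case
      using closed unfolding adjacent_def by blast
  qed
  with conn show "S = UNIV"
    by (auto simp: connected_hypergraph_def)
next
  assume closed: "\<forall>S. S \<noteq> {} \<longrightarrow> (\<forall>e\<in>E. e \<inter> S \<noteq> {} \<longrightarrow> e \<subseteq> S) \<longrightarrow> S = UNIV"
  show "connected_hypergraph E"
    unfolding connected_hypergraph_def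
  proof (intro allI)
    fix u v
    let ?C = "{w. (adjacent E)\<^sup>*\<^sup>* u w}"
    have "z \<in> ?C" if "e \<in> E" "y \<in> e" "y \<in> ?C" "z \<in> e" for e y z
    proof -
      have "adjacent E y z"
        using that by (auto simp: adjacent_def)
      with that show ?thesis
        by (auto intro: rtranclp.rtrancl_into_rtrancl)
    qed
    then have "\<forall>e\<in>E. e \<inter> ?C \<noteq> {} \<longrightarrow> e \<subseteq> ?C"
      by blast
    moreover have "u \<in> ?C"
      by simp
    ultimately have "?C = UNIV"
      using closed[rule_format, of ?C] by blast
    then have "v \<in> ?C"
      by simp
    then show "(adjacent E)\<^sup>*\<^sup>* u v"
      by simp
  qed
qed

theorem corollary9:
  fixes k :: nat and E :: "'n::finite set set"
  assumes "k \<ge> 2"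
    and "k_graph k E"
    and "\<forall>i. \<exists>e\<in>E. i \<in> e"
  shows "connected_hypergraph E \<longleftrightarrow>
    (minimal_binary_H_eigenvector k (laplacian_tensor k E) 0 (\<chi> i. 1) \<and>
     (\<forall>x. minimal_binary_H_eigenvector k (laplacian_tensor k E) 0 x \<longrightarrow> x = (\<chi> i. 1)))"
proof -
  note eig = H_eigenvector_laplacian_binary_iff[OF assms(2,1)]
  let ?one = "(\<chi> i. 1) :: real ^ 'n"
  have one: "binary_vec ?one" "supp ?one = UNIV"
    by (auto simp: binary_vec_def supp_def)
  then have one_eig: "H_eigenvector k (laplacian_tensor k E) 0 ?one"
    by (simp add: eig)
  show ?thesis
  proof
    assume "connected_hypergraph E"
    \<comment> \<open>With all supports full, none is properly contained in another, and a binary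
      vector of full support is \<open>?one\<close>.\<close>
    then have full: "supp x = UNIV" if "binary_vec x" "H_eigenvector k (laplacian_tensor k E) 0 x" for x
      using that eig[of x] by (simp add: connected_hypergraph_iff_closed)
    then have "minimal_binary_H_eigenvector k (laplacian_tensor k E) 0 ?one"
      using one one_eig by (auto simp: minimal_binary_H_eigenvector_def)
    moreover have "x = ?one" if "minimal_binary_H_eigenvector k (laplacian_tensor k E) 0 x" for x
    proof -
      have "binary_vec x" "supp x = UNIV"
        using that full by (auto simp: minimal_binary_H_eigenvector_def)
      then show ?thesis
        by (auto simp: vec_eq_iff binary_vec_def supp_def set_eq_iff)
    qed
    ultimately show "minimal_binary_H_eigenvector k (laplacian_tensor k E) 0 ?one \<and>
        (\<forall>x. minimal_binary_H_eigenvector k (laplacian_tensor k E) 0 x \<longrightarrow> x = ?one)"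
      by blast
  next
    assume "minimal_binary_H_eigenvector k (laplacian_tensor k E) 0 ?one \<and>
        (\<forall>x. minimal_binary_H_eigenvector k (laplacian_tensor k E) 0 x \<longrightarrow> x = ?one)"
    \<comment> \<open>Since \<open>?one\<close> has full support, any smaller support would
      contradict its minimality.\<close>
    then have minimal: "supp y = UNIV"
      if "binary_vec y" "H_eigenvector k (laplacian_tensor k E) 0 y" for y
      using that one by (auto simp: minimal_binary_H_eigenvector_def)
    have "S = UNIV" if S: "S \<noteq> {}" "\<forall>e\<in>E. e \<inter> S \<noteq> {} \<longrightarrow> e \<subseteq> S" for S
    proof -
      \<comment> \<open>The indicator vector of a closed nonempty \<open>S\<close> is a binary
        eigenvector, so its support \<open>S\<close> is full.\<close>
      let ?y = "(\<chi> i. of_bool (i \<in> S)) :: real ^ 'n"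
      have y: "binary_vec ?y" "supp ?y = S"
        by (auto simp: binary_vec_def supp_def)
      with S have "H_eigenvector k (laplacian_tensor k E) 0 ?y"
        by (simp add: eig)
      with minimal y show ?thesis
        by metis
    qed
    then show "connected_hypergraph E"
      by (simp add: connected_hypergraph_iff_closed)
  qed
qed

end
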